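(* Every loopless matroid $M$ satisfies $\chi_{i}^{mod}(M)=\chi(M)$.
   Context: Let $M$ be a loopless matroid on a finite ground set $E$. A coloring of $E$ is proper if the elements of each color class form an independent set of $M$. The chromatic number $\chi(M)$ is the minimum number of colors needed to color $E$ properly. The modified indicated coloring game on $M$ with a fixed finite color set $C$: Alice and Bob alternate turns. On Alice's turn, Alice indicates an uncolored element of $E$ and Bob colors it with a color from $C$; on Bob's turn, Bob indicates an uncolored element of $E$ and Alice colors it with a color from $C$. In all cases the coloring must remain proper. Alice wins if the whole of $E$ gets colored; Bob wins if a partial coloring is reached that cannot be properly extended. The modified indicated chromatic number $\chi_i^{mod}(M)$ is the minimum $|C|$ for which Alice has a winning strategy. *)

theory Defs
  imports Main
begin

locale matroid =
  fixes E :: "'a set" and indep :: "'a set \<Rightarrow> bool"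
  assumes finite_ground: "finite E"
    and indep_subset_ground: "indep X \<Longrightarrow> X \<subseteq> E"
    and indep_empty: "indep {}"
    and indep_mono: "indep Y \<Longrightarrow> X \<subseteq> Y \<Longrightarrow> indep X"
    and augment: "indep X \<Longrightarrow> indep Y \<Longrightarrow> card X < card Y \<Longrightarrow> \<exists>y\<in>Y - X. indep (insert y X)"

definition loopless :: "'a set \<Rightarrow> ('a set \<Rightarrow> bool) \<Rightarrow> bool" where
  "loopless E indep \<longleftrightarrow> (\<forall>e\<in>E. indep {e})"

text \<open>(Partial) colorings are partial maps from elements to colors.\<close>

definition proper :: "('a set \<Rightarrow> bool) \<Rightarrow> ('a \<rightharpoonup> 'c) \<Rightarrow> bool" where
  "proper indep f \<longleftrightarrow> (\<forall>c. indep {e. f e = Some c})"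

definition chromatic_number :: "'a set \<Rightarrow> ('a set \<Rightarrow> bool) \<Rightarrow> nat" where
  "chromatic_number E indep =
    (LEAST k. \<exists>(C :: nat set) f. finite C \<and> card C = k \<and> dom f = E \<and> ran f \<subseteq> C \<and> proper indep f)"

datatype player = Alice | Bob

fun opponent :: "player \<Rightarrow> player" where
  "opponent Alice = Bob"
| "opponent Bob = Alice"

text \<open>A history lists the rounds played so far, latest first, as pairs of an element and its color;
  the partial coloring reached is its \<open>map_of\<close>. A state consists of a history and possibly
  an element that has been indicated and is waiting for its color.
  The rules do not say who has the first turn, so this player is a parameter \<open>first\<close>.\<close>

type_synonym ('a, 'c) history = "('a \<times> 'c) list"
type_synonym ('a, 'c) state = "('a, 'c) history \<times> 'a option"

definition turn :: "player \<Rightarrow> ('a, 'c) history \<Rightarrow> player" where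
  "turn first h = (if even (length h) then first else opponent first)"

text \<open>A strategy of Alice: the element to indicate on her own turns, and the color to give to the
  element indicated by Bob on his turns.\<close>

record ('a, 'c) strategy =
  indicate :: "('a, 'c) history \<Rightarrow> 'a"
  respond :: "('a, 'c) history \<Rightarrow> 'a \<Rightarrow> 'c"

text \<open>The moves available when Alice follows a given strategy. A prescription that breaks the rules
  yields no move.\<close>

inductive move :: "'a set \<Rightarrow> ('a set \<Rightarrow> bool) \<Rightarrow> 'c set \<Rightarrow> player \<Rightarrow> ('a, 'c) strategy
    \<Rightarrow> ('a, 'c) state \<Rightarrow> ('a, 'c) state \<Rightarrow> bool"
  for E indep C first S where
  indicate: "e \<in> E \<Longrightarrow> e \<notin> dom (map_of h) \<Longrightarrow> (turn first h = Alice \<longrightarrow> e = indicate S h)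
    \<Longrightarrow> move E indep C first S (h, None) (h, Some e)"
| color: "c \<in> C \<Longrightarrow> proper indep (map_of ((e, c) # h)) \<Longrightarrow> (turn first h = Bob \<longrightarrow> c = respond S h e)
    \<Longrightarrow> move E indep C first S (h, Some e) ((e, c) # h, None)"

text \<open>Every play is finite, since each round colors a new element. Alice wins a play that has come to
  its end exactly if all of \<open>E\<close> is colored; otherwise she loses, in particular if an
  indicated element has no admissible color.\<close>

definition winning :: "'a set \<Rightarrow> ('a set \<Rightarrow> bool) \<Rightarrow> 'c set \<Rightarrow> player \<Rightarrow> ('a, 'c) strategy \<Rightarrow> bool" where
  "winning E indep C first S \<longleftrightarrow>
    (\<forall>h p. (move E indep C first S)\<^sup>*\<^sup>* ([], None) (h, p) \<and> \<not> (\<exists>s. move E indep C first S (h, p) s)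
      \<longrightarrow> dom (map_of h) = E)"

definition modified_indicated_chromatic_number ::
    "'a set \<Rightarrow> ('a set \<Rightarrow> bool) \<Rightarrow> player \<Rightarrow> nat" where
  "modified_indicated_chromatic_number E indep first =
    (LEAST k. \<exists>C :: nat set. finite C \<and> card C = k \<and> (\<exists>S. winning E indep C first S))"

text \<open>For a loopless matroid both minima range over nonempty sets.\<close>

lemma proper_coloring_exists:
  assumes "matroid E indep" "loopless E indep"
  shows "\<exists>k (C :: nat set) f. finite C \<and> card C = k \<and> dom f = E \<and> ran f \<subseteq> C \<and> proper indep f"
proof -
  interpret matroid E indep by fact
  obtain g :: "'a \<Rightarrow> nat" where g: "inj_on g E"
    using finite_imp_inj_to_nat_seg[OF finite_ground] by blast
  define f where "f = (\<lambda>e. if e \<in> E then Some (g e) else None)"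
  have "indep {e. f e = Some c}" for c
  proof (cases "\<exists>e\<in>E. g e = c")
    case True
    then obtain e where "e \<in> E" "g e = c" by blast
    then have "{e. f e = Some c} = {e}" using g by (auto simp: f_def inj_on_def split: if_splits)
    then show ?thesis using \<open>e \<in> E\<close> assms(2) by (simp add: loopless_def)
  next
    case False
    then have "{e. f e = Some c} = {}" by (auto simp: f_def)
    then show ?thesis using indep_empty by (simp only:)
  qed
  moreover have "dom f = E" "ran f \<subseteq> g ` E" by (auto simp: f_def dom_def ran_def split: if_splits)
  moreover have "finite (g ` E)" using finite_ground by simp
  ultimately show ?thesis unfolding proper_def by blast
qed

lemma winning_strategy_exists:
  assumes "matroid E indep" "loopless E indep"
  shows "\<exists>k (C :: nat set). finite C \<and> card C = k \<and> (\<exists>S. winning E indep C first S)"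
proof -
  interpret matroid E indep by fact
  let ?C = "{..<card E}"
  define S where "S = \<lparr>indicate = (\<lambda>h :: ('a, nat) history. SOME e. e \<in> E - fst ` set h),
    respond = (\<lambda>h e. SOME c. c \<in> ?C - snd ` set h)\<rparr>"
  define inv where "inv = (\<lambda>(h :: ('a, nat) history, p). distinct (map fst h) \<and> fst ` set h \<subseteq> E \<and>
    proper indep (map_of h) \<and> (\<forall>e. p = Some e \<longrightarrow> e \<in> E - fst ` set h))"
  have step: "inv s'" if "inv s" "move E indep ?C first S s s'" for s s'
    using that(2,1) by cases (auto simp: inv_def dom_map_of_conv_image_fst)
  have reach: "inv s" if "(move E indep ?C first S)\<^sup>*\<^sup>* ([], None) s" for s
    using that
  proof induction
    case base
    show ?case using indep_empty by (simp add: inv_def proper_def)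
  next
    case (step y z)
    then show ?case using \<open>\<And>s' s. inv s \<Longrightarrow> move E indep ?C first S s s' \<Longrightarrow> inv s'\<close> by blast
  qed
  have "winning E indep ?C first S"
    unfolding winning_def
  proof (intro allI impI, elim conjE)
    fix h p
    assume r: "(move E indep ?C first S)\<^sup>*\<^sup>* ([], None) (h, p)"
      and stuck: "\<not> (\<exists>s. move E indep ?C first S (h, p) s)"
    have i: "inv (h, p)" using reach[OF r] .
    show "dom (map_of h) = E"
    proof (cases p)
      case None
      show ?thesis
      proof (rule ccontr)
        assume "dom (map_of h) \<noteq> E"
        then have "\<exists>e. e \<in> E - fst ` set h"
          using i by (auto simp: inv_def dom_map_of_conv_image_fst)
        then have "indicate S h \<in> E - fst ` set h"
          unfolding S_def by (simp del: Diff_iff) (rule someI_ex)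
        then have "move E indep ?C first S (h, None) (h, Some (indicate S h))"
          by (intro move.indicate) (auto simp: dom_map_of_conv_image_fst)
        then show False using stuck None by blast
      qed
    next
      case (Some e)
      then have e: "e \<in> E - fst ` set h" using i by (simp add: inv_def)
      have "card (fst ` set h) < card E"
        using e i finite_ground by (intro psubset_card_mono) (auto simp: inv_def)
      moreover have "card (fst ` set h) = length h"
        using i distinct_card[of "map fst h"] by (simp add: inv_def)
      moreover have "card (snd ` set h) \<le> length h"
        using card_length[of "map snd h"] by simp
      ultimately have "card (snd ` set h) < card ?C" by simp
      then have "\<not> ?C \<subseteq> snd ` set h"
        by (metis List.finite_set card_mono finite_imageI not_le)
      then have "\<exists>c. c \<in> ?C - snd ` set h" by blast
      then have c: "respond S h e \<in> ?C - snd ` set h"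
        unfolding S_def by (simp del: Diff_iff) (rule someI_ex)
      let ?c = "respond S h e"
      have "proper indep (map_of ((e, ?c) # h))"
        unfolding proper_def
      proof
        fix d
        show "indep {x. map_of ((e, ?c) # h) x = Some d}"
        proof (cases "d = ?c")
          case True
          have "map_of h x \<noteq> Some ?c" for x
            using c by (force dest: map_of_SomeD)
          then have "{x. map_of ((e, ?c) # h) x = Some d} = {e}" using True by auto
          then show ?thesis using e assms(2) by (simp add: loopless_def)
        next
          case False
          then have "{x. map_of ((e, ?c) # h) x = Some d} \<subseteq> {x. map_of h x = Some d}" by auto
          moreover have "proper indep (map_of h)" using i by (simp add: inv_def)
          then have "indep {x. map_of h x = Some d}" unfolding proper_def by blast
          ultimately show ?thesis using indep_mono by blast
        qed
      qed
      then have "move E indep ?C first S (h, Some e) ((e, ?c) # h, None)"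
        using c by (intro move.color) auto
      then show ?thesis using stuck Some by blast
    qed
  qed
  then show ?thesis by blast
qed

end

theory Submission
  imports Defs
begin

text \<open>
  Write \<open>r\<close> for the rank, \<open>X\<^sub>c\<close> for the current color classes and \<open>D\<close> for the set of colored
  elements. Alice keeps the Rado-type condition \<open>|A| + |D| \<le> (\<Sum>c\<in>C. r (A \<union> X\<^sub>c))\<close> for all sets
  \<open>A\<close> of uncolored elements. It holds initially if a proper coloring exists. Call \<open>A\<close> tight if
  equality holds; by submodularity, tight sets are closed under union and intersection, and every
  function \<open>A \<mapsto> r (A \<union> X\<^sub>c)\<close> is modular on a pair of tight sets.

  On her turn Alice indicates an element \<open>e\<close> of a minimal nonempty tight set \<open>A\<close> (any element if
  there is none). A tight set \<open>B\<close> avoiding \<open>e\<close> is then disjoint from \<open>A\<close>, and modularity shows that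
  adding \<open>e\<close> to \<open>B \<union> X\<^sub>c\<close> raises the rank whenever \<open>c\<close> is an admissible color of \<open>e\<close>; so every answer
  of Bob preserves the condition. If Bob indicates \<open>e\<close> and no color preserved the condition, then
  every color would have a tight set \<open>B\<^sub>c\<close> with \<open>e\<close> in the closure of \<open>B\<^sub>c \<union> X\<^sub>c\<close>, and the condition
  would fail for the union of these sets together with \<open>e\<close>.
\<close>

section \<open>Rank\<close>

context matroid
begin

text \<open>Independent sets lie in the finite set \<open>E\<close>, so the maximum makes sense for
  arbitrary \<open>X\<close>.\<close>

definition rk :: "'a set \<Rightarrow> nat" where
  "rk X = Max (card ` {I. indep I \<and> I \<subseteq> X})"

lemma finite_indep: "finite {I. indep I \<and> I \<subseteq> X}"
  by (rule finite_subset[of _ "Pow E"]) (auto dest: indep_subset_ground simp: finite_ground)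

lemma indep_finite: "indep I \<Longrightarrow> finite I"
  using indep_subset_ground finite_ground finite_subset by blast

lemma card_le_rk: "indep I \<Longrightarrow> I \<subseteq> X \<Longrightarrow> card I \<le> rk X"
  unfolding rk_def by (rule Max_ge) (auto intro: finite_imageI finite_indep)

lemma rk_witness: obtains I where "indep I" "I \<subseteq> X" "card I = rk X"
proof -
  have "rk X \<in> card ` {I. indep I \<and> I \<subseteq> X}"
    unfolding rk_def
    by (rule Max_in) (use indep_empty in \<open>auto intro: finite_imageI finite_indep\<close>)
  then show ?thesis using that by auto
qed

lemma rk_indep: assumes "indep I" shows "rk I = card I"
proof (rule antisym)
  obtain J where "indep J" "J \<subseteq> I" "card J = rk I" by (rule rk_witness)
  then show "rk I \<le> card I" using card_mono[OF indep_finite[OF assms]] by metis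
qed (simp add: assms card_le_rk)

lemma rk_mono: assumes "X \<subseteq> Y" shows "rk X \<le> rk Y"
proof -
  obtain J where "indep J" "J \<subseteq> X" "card J = rk X" by (rule rk_witness)
  then show ?thesis using card_le_rk[of J Y] assms by auto
qed

text \<open>Take a largest independent set between \<open>I\<close> and \<open>X\<close>. If it had
  fewer than \<open>rk X\<close> elements, augmenting it from a witness of \<open>rk X\<close> would
  enlarge it.\<close>

lemma indep_extend:
  assumes "indep I" "I \<subseteq> X"
  obtains J where "indep J" "I \<subseteq> J" "J \<subseteq> X" "card J = rk X"
proof -
  have "\<exists>J. (indep J \<and> I \<subseteq> J \<and> J \<subseteq> X) \<and> (\<forall>K. indep K \<and> I \<subseteq> K \<and> K \<subseteq> X \<longrightarrow> card K \<le> card J)"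
    by (rule ex_has_greatest_nat[where k = I and b = "Suc (rk X)"])
      (use assms card_le_rk in \<open>auto simp: less_Suc_eq_le\<close>)
  then obtain J where J: "indep J" "I \<subseteq> J" "J \<subseteq> X"
    and max: "\<And>K. indep K \<Longrightarrow> I \<subseteq> K \<Longrightarrow> K \<subseteq> X \<Longrightarrow> card K \<le> card J" by blast
  have "\<not> card J < rk X"
  proof
    assume less: "card J < rk X"
    obtain L where L: "indep L" "L \<subseteq> X" "card L = rk X" by (rule rk_witness)
    obtain y where "y \<in> L - J" "indep (insert y J)" using augment[OF J(1) L(1)] less L(3) by auto
    then show False using max[of "insert y J"] J L indep_finite[OF J(1)] by auto
  qed
  then show ?thesis using that J card_le_rk[OF J(1,3)] by simp
qed

text \<open>Extend a basis \<open>I\<close> of the intersection to a basis \<open>J\<close> of the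
  union and count: \<open>J \<inter> X\<close> and \<open>J \<inter> Y\<close> are independent and
  both contain \<open>I\<close>.\<close>

lemma rk_submodular: "rk (X \<union> Y) + rk (X \<inter> Y) \<le> rk X + rk Y"
proof -
  obtain I where I: "indep I" "I \<subseteq> X \<inter> Y" "card I = rk (X \<inter> Y)" by (rule rk_witness)
  then obtain J where J: "indep J" "I \<subseteq> J" "J \<subseteq> X \<union> Y" "card J = rk (X \<union> Y)"
    using indep_extend[of I "X \<union> Y"] by blast
  have fin: "finite J" using J(1) by (rule indep_finite)
  have "card I \<le> card ((J \<inter> X) \<inter> (J \<inter> Y))"
    using I J fin by (intro card_mono) auto
  moreover have "(J \<inter> X) \<union> (J \<inter> Y) = J" using J by blast
  then have "card J + card ((J \<inter> X) \<inter> (J \<inter> Y)) = card (J \<inter> X) + card (J \<inter> Y)"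
    using card_Un_Int[of "J \<inter> X" "J \<inter> Y"] fin by simp
  moreover have "card (J \<inter> X) \<le> rk X" "card (J \<inter> Y) \<le> rk Y"
    using J(1) by (auto intro!: card_le_rk intro: indep_mono)
  ultimately show ?thesis using I J by linarith
qed

lemma rk_submodular_Un:
  "rk ((A \<union> B) \<union> Z) + rk ((A \<inter> B) \<union> Z) \<le> rk (A \<union> Z) + rk (B \<union> Z)"
proof -
  have "(A \<union> Z) \<union> (B \<union> Z) = (A \<union> B) \<union> Z" "(A \<union> Z) \<inter> (B \<union> Z) = (A \<inter> B) \<union> Z" by auto
  then show ?thesis using rk_submodular[of "A \<union> Z" "B \<union> Z"] by simp
qed

text \<open>Monotonicity of closure, by submodularity of \<open>insert e X\<close> and
  \<open>Y\<close>.\<close>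

lemma rk_insert_le_mono:
  assumes "rk (insert e X) \<le> rk X" "X \<subseteq> Y"
  shows "rk (insert e Y) \<le> rk Y"
proof -
  have "rk (insert e X \<union> Y) + rk (insert e X \<inter> Y) \<le> rk (insert e X) + rk Y"
    by (rule rk_submodular)
  moreover have "insert e X \<union> Y = insert e Y" "X \<subseteq> insert e X \<inter> Y" using assms by auto
  ultimately show ?thesis using assms(1) rk_mono[of X "insert e X \<inter> Y"] by auto
qed

lemma rk_insert_dependent:
  assumes "indep X" "\<not> indep (insert e X)"
  shows "rk (insert e X) \<le> rk X"
proof -
  obtain J where J: "indep J" "X \<subseteq> J" "J \<subseteq> insert e X" "card J = rk (insert e X)"
    using indep_extend[of X "insert e X"] assms(1) by blast
  have "J \<noteq> insert e X" using J(1) assms(2) by blast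
  then have "J = X" using J(2,3) by auto
  then show ?thesis using J(4) rk_indep[OF assms(1)] by simp
qed

section \<open>The rank condition and tight sets\<close>

definition color_class :: "('a \<rightharpoonup> 'c) \<Rightarrow> 'c \<Rightarrow> 'a set" where
  "color_class m c = {e. m e = Some c}"

text \<open>For proper \<open>m\<close> with colors in \<open>C\<close>, \<open>card (dom m)\<close>
  is the sum of the sizes of the color classes. Moved to the right, it turns each summand into the
  rank of \<open>A\<close> in the contraction by a color class: this is the matroid union condition
  for those contractions, written without subtraction.\<close>

definition rado :: "'c set \<Rightarrow> ('a \<rightharpoonup> 'c) \<Rightarrow> bool" where
  "rado C m \<longleftrightarrow>
    (\<forall>A \<subseteq> E - dom m. card A + card (dom m) \<le> (\<Sum>c\<in>C. rk (A \<union> color_class m c)))"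

definition tight :: "'c set \<Rightarrow> ('a \<rightharpoonup> 'c) \<Rightarrow> 'a set \<Rightarrow> bool" where
  "tight C m A \<longleftrightarrow>
    A \<subseteq> E - dom m \<and> card A + card (dom m) = (\<Sum>c\<in>C. rk (A \<union> color_class m c))"

lemma radoD:
  "rado C m \<Longrightarrow> A \<subseteq> E - dom m \<Longrightarrow> card A + card (dom m) \<le> (\<Sum>c\<in>C. rk (A \<union> color_class m c))"
  by (simp add: rado_def)

lemma proper_color_class: "proper indep m \<longleftrightarrow> (\<forall>c. indep (color_class m c))"
  by (simp add: proper_def color_class_def)

lemma color_class_upd:
  "e \<notin> dom m \<Longrightarrow>
    color_class (m(e \<mapsto> c)) d = (if d = c then insert e (color_class m d) else color_class m d)"
  by (auto simp: color_class_def)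

lemma proper_upd:
  assumes "proper indep m" "e \<notin> dom m"
  shows "proper indep (m(e \<mapsto> c)) \<longleftrightarrow> indep (insert e (color_class m c))"
  using assms by (auto simp: proper_color_class color_class_upd)

section \<open>The lattice of tight sets\<close>

text \<open>Submodularity summed over the colors bounds the two rank sums from above,
  \<open>rado\<close> bounds them from below, and cardinality is modular, so all are equalities.
  Termwise inequalities with equal sums are termwise equalities.\<close>

lemma tight_Un_Int:
  assumes "finite C" "rado C m" "tight C m A" "tight C m B"
  shows "tight C m (A \<union> B)" "tight C m (A \<inter> B)"
    and "\<And>c. c \<in> C \<Longrightarrow> rk ((A \<union> B) \<union> color_class m c) + rk ((A \<inter> B) \<union> color_class m c)
      = rk (A \<union> color_class m c) + rk (B \<union> color_class m c)"
proof -
  let ?r = "\<lambda>A c. rk (A \<union> color_class m c)"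
  have sub: "A \<subseteq> E - dom m" "B \<subseteq> E - dom m" using assms by (auto simp: tight_def)
  then have fin: "finite A" "finite B" using finite_ground by (auto intro: finite_subset)
  have le: "?r (A \<union> B) c + ?r (A \<inter> B) c \<le> ?r A c + ?r B c" for c by (rule rk_submodular_Un)
  have sum_le: "(\<Sum>c\<in>C. ?r (A \<union> B) c + ?r (A \<inter> B) c) \<le> (\<Sum>c\<in>C. ?r A c + ?r B c)"
    by (intro sum_mono le)
  have 1: "card (A \<union> B) + card (dom m) \<le> sum (?r (A \<union> B)) C"
    "card (A \<inter> B) + card (dom m) \<le> sum (?r (A \<inter> B)) C"
    using sub by (auto intro!: radoD[OF assms(2)])
  have 2: "card A + card (dom m) = sum (?r A) C" "card B + card (dom m) = sum (?r B) C"
    using assms by (auto simp: tight_def)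
  note 3 = card_Un_Int[OF fin]
  show "tight C m (A \<union> B)" "tight C m (A \<inter> B)"
    using 1 2 3 sum_le sub unfolding tight_def sum.distrib by auto
  have eq: "(\<Sum>c\<in>C. ?r (A \<union> B) c + ?r (A \<inter> B) c) = (\<Sum>c\<in>C. ?r A c + ?r B c)"
    using 1 2 3 sum_le unfolding sum.distrib by linarith
  show "?r (A \<union> B) c + ?r (A \<inter> B) c = ?r A c + ?r B c" if "c \<in> C" for c
    by (rule sum_mono_inv[OF eq]) (use le that assms(1) in auto)
qed

text \<open>The classes are disjoint independent subsets of \<open>dom m\<close>, so their ranks sum
  to at most \<open>card (dom m)\<close>; \<open>rado\<close> gives the reverse inequality.\<close>

lemma tight_empty:
  assumes "finite C" "rado C m" "proper indep m" "finite (dom m)"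
  shows "tight C m {}"
proof -
  have "(\<Sum>c\<in>C. rk ({} \<union> color_class m c)) = (\<Sum>c\<in>C. card (color_class m c))"
    using assms(3) by (simp add: proper_color_class rk_indep)
  also have "\<dots> = card (\<Union>c\<in>C. color_class m c)"
    by (rule card_UN_disjoint[symmetric])
      (use assms(1,3) indep_finite in \<open>auto simp: proper_color_class\<close>, auto simp: color_class_def)
  also have "\<dots> \<le> card (dom m)"
    by (rule card_mono) (use assms(4) in \<open>auto simp: color_class_def\<close>)
  finally show ?thesis using radoD[OF assms(2), of "{}"] by (simp add: tight_def)
qed

lemma tight_UN:
  assumes "finite I" "finite C" "rado C m" "tight C m {}" "\<And>i. i \<in> I \<Longrightarrow> tight C m (B i)"
  shows "tight C m (\<Union>i\<in>I. B i)"
  using assms(1,5)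
proof induction
  case empty
  show ?case using assms(4) by simp
next
  case (insert i I)
  then have "tight C m (B i \<union> (\<Union>i\<in>I. B i))" by (intro tight_Un_Int(1)[OF assms(2,3)]) auto
  then show ?case by simp
qed

section \<open>Preserving the rank condition in one round\<close>

text \<open>Coloring \<open>e\<close> raises the left side by one and changes only the summand of
  \<open>c\<close>, which cannot drop. Sets that are not tight have slack for this; for tight sets
  that summand must grow.\<close>

lemma rado_upd:
  assumes "finite C" "c \<in> C" "rado C m" "finite (dom m)" "e \<in> E - dom m"
    and "\<And>B. tight C m B \<Longrightarrow> e \<notin> B \<Longrightarrow>
      rk (B \<union> color_class m c) < rk (insert e (B \<union> color_class m c))"
  shows "rado C (m(e \<mapsto> c))"
  unfolding rado_def
proof (intro allI impI)
  fix B assume B: "B \<subseteq> E - dom (m(e \<mapsto> c))"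
  have *: "(\<Sum>d\<in>C. rk (B \<union> color_class (m(e \<mapsto> c)) d))
    = rk (insert e (B \<union> color_class m c)) + (\<Sum>d\<in>C-{c}. rk (B \<union> color_class m d))"
    using assms(1,2,5) by (subst sum.remove[of _ c]) (auto simp: color_class_upd)
  have **: "(\<Sum>d\<in>C. rk (B \<union> color_class m d))
    = rk (B \<union> color_class m c) + (\<Sum>d\<in>C-{c}. rk (B \<union> color_class m d))"
    using assms(1,2) by (rule sum.remove)
  have dom: "card (dom (m(e \<mapsto> c))) = Suc (card (dom m))" using assms(4,5) by simp
  have sub: "B \<subseteq> E - dom m" "e \<notin> B" using B by auto
  have mono: "rk (B \<union> color_class m c) \<le> rk (insert e (B \<union> color_class m c))"
    by (rule rk_mono) auto
  show "card B + card (dom (m(e \<mapsto> c))) \<le> (\<Sum>d\<in>C. rk (B \<union> color_class (m(e \<mapsto> c)) d))"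
  proof (cases "tight C m B")
    case True
    then show ?thesis using assms(6)[OF True sub(2)] * ** dom by (simp add: tight_def)
  next
    case False
    then show ?thesis using radoD[OF assms(3) sub(1)] sub * ** dom mono by (simp add: tight_def)
  qed
qed

lemma rado_response_exists:
  assumes "finite C" "rado C m" "proper indep m" "finite (dom m)" "e \<in> E - dom m"
  shows "\<exists>c\<in>C. proper indep (m(e \<mapsto> c)) \<and> rado C (m(e \<mapsto> c))"
proof (rule ccontr)
  assume neg: "\<not> ?thesis"
  have empty: "tight C m {}" by (rule tight_empty) fact+
  have "\<exists>B. tight C m B \<and> e \<notin> B \<and> rk (insert e (B \<union> color_class m c)) \<le> rk (B \<union> color_class m c)"
    if "c \<in> C" for c
  proof (cases "proper indep (m(e \<mapsto> c))")
    case True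
    then have "\<not> rado C (m(e \<mapsto> c))" using neg that by blast
    then show ?thesis using rado_upd[OF assms(1) that assms(2,4,5)] by (meson not_le)
  next
    case False
    \<comment> \<open>An inadmissible color is already blocked by the tight set
      \<open>{}\<close>.\<close>
    then have "rk (insert e (color_class m c)) \<le> rk (color_class m c)"
      using assms(3,5) proper_upd[OF assms(3), of e c]
      by (intro rk_insert_dependent) (auto simp: proper_color_class)
    then show ?thesis using empty by (intro exI[of _ "{}"]) simp
  qed
  then obtain B where B: "\<And>c. c \<in> C \<Longrightarrow> tight C m (B c)" "\<And>c. c \<in> C \<Longrightarrow> e \<notin> B c"
    "\<And>c. c \<in> C \<Longrightarrow> rk (insert e (B c \<union> color_class m c)) \<le> rk (B c \<union> color_class m c)" by metis
  let ?B = "\<Union>c\<in>C. B c"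
  have t: "tight C m ?B" using assms(1,2) empty B(1) by (intro tight_UN)
  have e: "e \<notin> ?B" using B(2) by blast
  have sub: "?B \<subseteq> E - dom m" using t by (simp only: tight_def)
  then have fin: "finite ?B" using finite_ground by (auto intro: finite_subset)
  \<comment> \<open>Adding \<open>e\<close> to the tight set \<open>?B\<close> raises the left side,
    but by monotonicity of closure no rank on the right.\<close>
  have "Suc (card ?B) + card (dom m) = card (insert e ?B) + card (dom m)" using fin e by simp
  also have "\<dots> \<le> (\<Sum>c\<in>C. rk (insert e ?B \<union> color_class m c))"
    using sub assms(5) by (intro radoD[OF assms(2)]) simp
  also have "\<dots> \<le> (\<Sum>c\<in>C. rk (?B \<union> color_class m c))"
  proof (rule sum_mono)
    fix c assume c: "c \<in> C"
    have "rk (insert e (?B \<union> color_class m c)) \<le> rk (?B \<union> color_class m c)"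
      by (rule rk_insert_le_mono[OF B(3)[OF c]]) (use c in auto)
    then show "rk (insert e ?B \<union> color_class m c) \<le> rk (?B \<union> color_class m c)" by simp
  qed
  also have "\<dots> = card ?B + card (dom m)" using t by (simp only: tight_def)
  finally show False by simp
qed

lemma rado_indication_exists:
  assumes "finite C" "rado C m" "proper indep m" "finite (dom m)" "E - dom m \<noteq> {}"
  shows "\<exists>e\<in>E - dom m. \<forall>c\<in>C. proper indep (m(e \<mapsto> c)) \<longrightarrow> rado C (m(e \<mapsto> c))"
proof (cases "\<exists>A. tight C m A \<and> A \<noteq> {}")
  case False
  have "rado C (m(e \<mapsto> c))" if "e \<in> E - dom m" "c \<in> C" "proper indep (m(e \<mapsto> c))" for e c
  proof (rule rado_upd[OF assms(1) that(2) assms(2,4) that(1)])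
    \<comment> \<open>For the only tight set \<open>{}\<close>, the required growth in rank is
      properness of the new coloring.\<close>
    fix B assume "tight C m B"
    then have "B = {}" using False by blast
    moreover have "e \<notin> color_class m c" using that(1) by (auto simp: color_class_def)
    moreover have "indep (color_class m c)" "indep (insert e (color_class m c))"
      using that assms(3) proper_upd[OF assms(3), of e c] by (auto simp: proper_color_class)
    ultimately show "rk (B \<union> color_class m c) < rk (insert e (B \<union> color_class m c))"
      by (simp add: rk_indep indep_finite)
  qed
  then show ?thesis using assms(5) by blast
next
  case True
  then obtain A where A: "tight C m A" "A \<noteq> {}"
    and min: "\<And>B. tight C m B \<Longrightarrow> B \<noteq> {} \<Longrightarrow> card A \<le> card B"
    using ex_has_least_nat[of "\<lambda>A. tight C m A \<and> A \<noteq> {}" _ card] by blast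
  then obtain e where e: "e \<in> A" by blast
  have sub: "A \<subseteq> E - dom m" using A by (simp add: tight_def)
  then have fin: "finite A" using finite_ground by (auto intro: finite_subset)
  have "rado C (m(e \<mapsto> c))" if c: "c \<in> C" "proper indep (m(e \<mapsto> c))" for c
  proof (rule rado_upd[OF assms(1) c(1) assms(2,4)])
    let ?X = "color_class m c"
    show "e \<in> E - dom m" using e sub by blast
    fix B assume B: "tight C m B" "e \<notin> B"
    note AB = tight_Un_Int[OF assms(1,2) A(1) B(1)]
    have disj: "A \<inter> B = {}"
    proof (rule ccontr)
      assume "A \<inter> B \<noteq> {}"
      then have "card A \<le> card (A \<inter> B)" using min AB(2) by blast
      moreover have "card (A \<inter> B) < card A"
        using fin e B(2) by (intro psubset_card_mono) auto
      ultimately show False by simp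
    qed
    then have mod: "rk (A \<union> B \<union> ?X) + rk ?X = rk (A \<union> ?X) + rk (B \<union> ?X)"
      using AB(3)[OF c(1)] by simp
    have "e \<notin> dom m" using e sub by blast
    then have "indep ?X" "indep (insert e ?X)" "e \<notin> ?X"
      using c(2) assms(3) proper_upd[OF assms(3), of e c]
      by (simp_all add: proper_color_class) (auto simp: color_class_def)
    then have nonloop: "rk ?X < rk (insert e ?X)" by (simp add: rk_indep indep_finite)
    \<comment> \<open>As \<open>e\<close> lies in \<open>A\<close>, putting it into \<open>B\<close>
      leaves the union with \<open>A\<close> unchanged and makes the intersection
      \<open>{e}\<close>. Compared with \<open>mod\<close>, this carries the rank increase at
      \<open>?X\<close> over to \<open>B \<union> ?X\<close>.\<close>
    have "rk ((insert e B \<union> A) \<union> ?X) + rk ((insert e B \<inter> A) \<union> ?X) \<le> rk (insert e B \<union> ?X) + rk (A \<union> ?X)"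
      by (rule rk_submodular_Un)
    moreover have "(insert e B \<union> A) \<union> ?X = A \<union> B \<union> ?X" "(insert e B \<inter> A) \<union> ?X = insert e ?X"
      "insert e B \<union> ?X = insert e (B \<union> ?X)" using e disj by auto
    ultimately have "rk (A \<union> B \<union> ?X) + rk (insert e ?X) \<le> rk (insert e (B \<union> ?X)) + rk (A \<union> ?X)"
      by (simp only:)
    then show "rk (B \<union> ?X) < rk (insert e (B \<union> ?X))" using mod nonloop by linarith
  qed
  then show ?thesis using e sub by blast
qed

text \<open>The color classes of \<open>f\<close> cut \<open>A\<close> into independent pieces, each
  of size at most \<open>rk A\<close>.\<close>

lemma rado_empty:
  fixes C :: "'c set"
  assumes "finite C" "dom f = E" "ran f \<subseteq> C" "proper indep f"
  shows "rado C Map.empty"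
  unfolding rado_def
proof (intro allI impI)
  fix A assume "A \<subseteq> E - dom (Map.empty :: 'a \<rightharpoonup> 'c)"
  then have A: "A \<subseteq> E" by simp
  then have fin: "finite A" using finite_ground finite_subset by blast
  have "A = (\<Union>c\<in>C. A \<inter> color_class f c)"
    using A assms(2,3) by (fastforce simp: color_class_def ran_def)
  then have "card A \<le> (\<Sum>c\<in>C. card (A \<inter> color_class f c))"
    using card_UN_le[OF assms(1), of "\<lambda>c. A \<inter> color_class f c"] by simp
  also have "\<dots> \<le> (\<Sum>c\<in>C. rk A)"
    by (intro sum_mono card_le_rk)
      (use assms(4) in \<open>auto simp: proper_color_class intro: indep_mono\<close>)
  finally show "card A + card (dom (Map.empty :: 'a \<rightharpoonup> 'c))
      \<le> (\<Sum>c\<in>C. rk (A \<union> color_class (Map.empty :: 'a \<rightharpoonup> 'c) c))"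
    by (simp add: color_class_def)
qed

section \<open>The game\<close>

lemma winning_if_proper_coloring:
  assumes C: "finite C" and f: "dom f = E" "ran f \<subseteq> C" "proper indep f"
  shows "\<exists>S. winning E indep C first S"
proof -
  define good where "good m e \<longleftrightarrow> e \<in> E - dom m \<and>
    (\<forall>c\<in>C. proper indep (m(e \<mapsto> c)) \<longrightarrow> rado C (m(e \<mapsto> c)))" for m e
  define answer where "answer m e c \<longleftrightarrow> c \<in> C \<and> proper indep (m(e \<mapsto> c)) \<and> rado C (m(e \<mapsto> c))" for m e c
  define S where "S = \<lparr>indicate = (\<lambda>h. SOME e. good (map_of h) e),
    respond = (\<lambda>h e. SOME c. answer (map_of h) e c)\<rparr>"
  define ok where "ok = (\<lambda>m. dom m \<subseteq> E \<and> proper indep m \<and> rado C m)"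
  \<comment> \<open>Bob may color an element indicated by Alice with any admissible color, so the
    invariant must remember that it is \<open>good\<close>. For an element indicated by Bob, Alice
    finds an answer whatever it is.\<close>
  define inv where "inv = (\<lambda>(h, p). ok (map_of h) \<and> (\<forall>e. p = Some e \<longrightarrow>
    e \<in> E - dom (map_of h) \<and> (turn first h = Alice \<longrightarrow> good (map_of h) e)))"
  have good_indicate: "good (map_of h) (indicate S h)" if "ok (map_of h)" "dom (map_of h) \<noteq> E" for h
  proof -
    have "E - dom (map_of h) \<noteq> {}" using that by (auto simp: ok_def)
    then have "\<exists>e. good (map_of h) e"
      using rado_indication_exists[OF C, of "map_of h"] that(1) finite_dom_map_of[of h]
      unfolding ok_def good_def by blast
    then show ?thesis unfolding S_def by (simp add: someI_ex)
  qed
  have answer: "\<exists>c. answer (map_of h) e c" if "ok (map_of h)" "e \<in> E - dom (map_of h)" for h e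
    using rado_response_exists[OF C, of "map_of h" e] that
      finite_dom_map_of[of h]
    unfolding ok_def answer_def by blast
  then have respond: "answer (map_of h) e (respond S h e)"
    if "ok (map_of h)" "e \<in> E - dom (map_of h)" for h e
    using that unfolding S_def by (simp add: someI_ex)
  have step: "inv s'" if "inv s" "move E indep C first S s s'" for s s'
    using that(2)
  proof cases
    case (indicate e h)
    then show ?thesis using that(1) good_indicate[of h] by (auto simp: inv_def)
  next
    case (color c e h)
    have i: "ok (map_of h)" "e \<in> E - dom (map_of h)" "turn first h = Alice \<longrightarrow> good (map_of h) e"
      using that(1) color(1) by (auto simp: inv_def)
    have "rado C ((map_of h)(e \<mapsto> c))"
    proof (cases "turn first h")
      case Alice
      then show ?thesis using i color by (simp add: good_def)
    next
      case Bob
      then show ?thesis using respond[OF i(1,2)] color by (simp add: answer_def)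
    qed
    then show ?thesis using i color by (auto simp: inv_def ok_def)
  qed
  have reach: "inv s" if "(move E indep C first S)\<^sup>*\<^sup>* ([], None) s" for s
    using that
  proof induction
    case base
    show ?case using indep_empty rado_empty[OF C f] by (simp add: inv_def ok_def proper_def)
  qed (rule step)
  have "winning E indep C first S"
    unfolding winning_def
  proof (intro allI impI, elim conjE)
    fix h p
    assume r: "(move E indep C first S)\<^sup>*\<^sup>* ([], None) (h, p)"
      and stuck: "\<not> (\<exists>s. move E indep C first S (h, p) s)"
    have i: "inv (h, p)" using reach[OF r] .
    show "dom (map_of h) = E"
    proof (cases p)
      case None
      show ?thesis
      proof (rule ccontr)
        assume "dom (map_of h) \<noteq> E"
        then have "good (map_of h) (indicate S h)" using i good_indicate by (simp add: inv_def)
        then have "move E indep C first S (h, None) (h, Some (indicate S h))"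
          by (intro move.indicate) (auto simp: good_def)
        then show False using stuck None by blast
      qed
    next
      case (Some e)
      \<comment> \<open>When Bob is the one to color, this color is open to him too, so no pending
        element blocks the play.\<close>
      then have "answer (map_of h) e (respond S h e)" using i by (intro respond) (auto simp: inv_def)
      then have "move E indep C first S (h, Some e) ((e, respond S h e) # h, None)"
        by (intro move.color) (auto simp: answer_def)
      then show ?thesis using stuck Some by blast
    qed
  qed
  then show ?thesis by blast
qed

text \<open>Each move increases \<open>2 * length h + (if p = None then 0 else 1)\<close>, so a reachable state that
  maximizes this quantity ends a play.\<close>

lemma proper_coloring_if_winning:
  assumes "winning E indep C first S"
  shows "\<exists>f. dom f = E \<and> ran f \<subseteq> C \<and> proper indep f"
proof -
  define inv where "inv = (\<lambda>(h, p). distinct (map fst h) \<and> fst ` set h \<subseteq> E \<and> snd ` set h \<subseteq> C \<and>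
    proper indep (map_of h) \<and> (\<forall>e. p = Some e \<longrightarrow> e \<in> E - fst ` set h))"
  define size where "size = (\<lambda>(h :: ('a \<times> 'b) list, p :: 'a option).
    2 * length h + (if p = None then 0 else 1))"
  let ?reach = "(move E indep C first S)\<^sup>*\<^sup>* ([], None)"
  have reach: "inv s" if "?reach s" for s
    using that
  proof induction
    case base
    show ?case using indep_empty by (simp add: inv_def proper_def)
  next
    case (step y z)
    from step(2,3) show ?case by cases (auto simp: inv_def dom_map_of_conv_image_fst)
  qed
  \<comment> \<open>At most \<open>card E\<close> rounds count two each, and a pending element adds
    one.\<close>
  have "size s < 2 * card E + 2" if "?reach s" for s
  proof -
    obtain h p where s: "s = (h, p)" by fastforce
    have "length h = card (fst ` set h)"
      using reach[OF that] s distinct_card[of "map fst h"] by (simp add: inv_def)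
    also have "\<dots> \<le> card E"
      using reach[OF that] s finite_ground by (intro card_mono) (auto simp: inv_def)
    finally show ?thesis using s by (simp add: size_def)
  qed
  then have "\<exists>s. ?reach s \<and> (\<forall>t. ?reach t \<longrightarrow> size t \<le> size s)"
    by (intro ex_has_greatest_nat[where k = "([], None)" and b = "2 * card E + 2"]) auto
  then obtain s where s: "?reach s" and max: "\<And>t. ?reach t \<Longrightarrow> size t \<le> size s" by blast
  have "size s < size t" if "move E indep C first S s t" for t
    using that by cases (auto simp: size_def)
  then have stuck: "\<not> (\<exists>t. move E indep C first S s t)"
    using max rtranclp.rtrancl_into_rtrancl[OF s] by (meson not_le)
  obtain h p where hp: "s = (h, p)" by fastforce
  have "dom (map_of h) = E" using assms s stuck unfolding hp winning_def by blast
  moreover have "proper indep (map_of h)" "snd ` set h \<subseteq> C"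
    using reach[OF s] by (auto simp: inv_def hp)
  moreover have "ran (map_of h) \<subseteq> snd ` set h" by (force simp: ran_def dest: map_of_SomeD)
  ultimately show ?thesis by blast
qed

end

theorem theorem4:
  fixes E :: "'a set" and indep :: "'a set \<Rightarrow> bool" and first :: player
  assumes "matroid E indep" and "loopless E indep"
  shows "modified_indicated_chromatic_number E indep first = chromatic_number E indep"
proof -
  interpret matroid E indep by fact
  \<comment> \<open>Each color set qualifies for both minima or for neither.\<close>
  have "(finite C \<and> card C = k \<and> (\<exists>S. winning E indep C first S)) \<longleftrightarrow>
      (\<exists>f. finite C \<and> card C = k \<and> dom f = E \<and> ran f \<subseteq> C \<and> proper indep f)"
    for C :: "nat set" and k
    using winning_if_proper_coloring[of C _ first] proper_coloring_if_winning[of C first] by metis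
  then show ?thesis
    unfolding modified_indicated_chromatic_number_def chromatic_number_def by simp
qed

end
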